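(* Let $(R,S)$ be a generalized Rota-Baxter system on an $A$-bimodule $M$ over an associative algebra $A$, and let $(R_t=\sum_{i=0}^Nt^iR_i,\ S_t=\sum_{i=0}^Nt^iS_i)$ be a deformation of order $N$ of $(R,S)$. Then the obstruction $$Ob_{(R_t,S_t)}=-\frac12\sum_{i+j=N+1,\ i,j\ge1}\llbracket(R_i,S_i),(R_j,S_j)\rrbracket\in\mathrm{Hom}(M^{\otimes2},A\oplus A)$$ is a $2$-cocycle in the cohomology of the generalized Rota-Baxter system $(R,S)$, i.e. $d_{(R,S)}(Ob_{(R_t,S_t)})=0$.
   Context: All vector spaces are over a field $\mathbb{K}$ of characteristic zero. A generalized Rota-Baxter system on an $A$-bimodule $M$ over $A$ is a pair of linear maps $R,S:M\to A$ with $R(u)R(v)=R(R(u)\cdot v+u\cdot S(v))$ and $S(u)S(v)=S(R(u)\cdot v+u\cdot S(v))$ for all $u,v\in M$. A deformation of order $N$ of $(R,S)$ consists of finite sums $R_t=\sum_{i=0}^Nt^iR_i$, $S_t=\sum_{i=0}^Nt^iS_i$ with $R_i,S_i\in\mathrm{Hom}(M,A)$, $R_0=R$, $S_0=S$, such that $(R_t,S_t)$ is a generalized Rota-Baxter system on the bimodule $M[[t]]/(t^{N+1})$ over the $\mathbb{K}[[t]]/(t^{N+1})$-algebra $A[[t]]/(t^{N+1})$ (structures extended $\mathbb{K}[[t]]/(t^{N+1})$-bilinearly). Bracket: for $F=(F_1,F_2)\in\mathrm{Hom}(M^{\otimes m},A\oplus A)$ and $G=(G_1,G_2)\in\mathrm{Hom}(M^{\otimes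 n},A\oplus A)$, $m,n\ge0$, $\llbracket F,G\rrbracket\in\mathrm{Hom}(M^{\otimes(m+n)},A\oplus A)$ has components, $k=1,2$, \begin{align*} \llbracket F,G\rrbracket_k(u_1,\dots,u_{m+n})=&\sum_{i=1}^m(-1)^{(i-1)n}F_k(u_1,\dots,u_{i-1},G_1(u_i,\dots,u_{i+n-1})\cdot u_{i+n},\dots,u_{m+n})\\ &-\sum_{i=1}^m(-1)^{in}F_k(u_1,\dots,u_{i-1},u_i\cdot G_2(u_{i+1},\dots,u_{i+n}),u_{i+n+1},\dots,u_{m+n})\\ &-(-1)^{mn}\Big\{\sum_{i=1}^n(-1)^{(i-1)m}G_k(u_1,\dots,u_{i-1},F_1(u_i,\dots,u_{i+m-1})\cdot u_{i+m},\dots,u_{m+n})\\ &\qquad-\sum_{i=1}^n(-1)^{im}G_k(u_1,\dots,u_{i-1},u_i\cdot F_2(u_{i+1},\dots,u_{i+m}),u_{i+m+1},\dots,u_{m+n})\Big\}\\ &+(-1)^{mn}\big[F_k(u_1,\dots,u_m)G_k(u_{m+1},\dots,u_{m+n})-(-1)^{mn}G_k(u_1,\dots,u_n)F_k(u_{n+1},\dots,u_{m+n})\big]. \end{align*} The cohomology $H^\bullet(M,A)$ of $(R,S)$ is that of $C^n(M,A)=\mathrm{Hom}(M^{\otimes n},A\oplus A)$, $n\ge0$, with differential $d_{(R,S)}=\llbracket(R,S),\cdot\rrbracket$. *)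

theory Defs
  imports
    "HOL-Analysis.Product_Vector"
    "HOL-Computational_Algebra.Formal_Power_Series"
begin

text \<open>
  The algebra is the type \<open>'a\<close> of class \<open>ring\<close>: associative, not assumed unital.
\<close>

locale algebra_bimodule =
  A: vector_space scaleA + M: vector_space scaleM
  for scaleA :: "'k::field_char_0 \<Rightarrow> 'a::ring \<Rightarrow> 'a"
    and scaleM :: "'k \<Rightarrow> 'm::ab_group_add \<Rightarrow> 'm" +
  fixes lact :: "'a \<Rightarrow> 'm \<Rightarrow> 'm"
    and ract :: "'m \<Rightarrow> 'a \<Rightarrow> 'm"
  assumes scaleA_mult_left: "scaleA c a * b = scaleA c (a * b)"
    and scaleA_mult_right: "a * scaleA c b = scaleA c (a * b)"
    and lact_linear_left: "module_hom scaleA scaleM (\<lambda>a. lact a u)"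
    and lact_linear_right: "module_hom scaleM scaleM (lact a)"
    and ract_linear_left: "module_hom scaleM scaleM (\<lambda>u. ract u a)"
    and ract_linear_right: "module_hom scaleA scaleM (ract u)"
    and lact_mult: "lact (a * b) u = lact a (lact b u)"
    and ract_mult: "ract u (a * b) = ract (ract u a) b"
    and lact_ract: "ract (lact a u) b = lact a (ract u b)"

text \<open>
  Scalars, algebra and module are given by explicit carriers, and all products by explicit
  operations, so that the same definition applies to an algebra over the field and to truncated
  power series.
\<close>

definition linear_on ::
  "'k set \<Rightarrow> 'm::plus set \<Rightarrow> 'a::plus set \<Rightarrow> ('k \<Rightarrow> 'm \<Rightarrow> 'm) \<Rightarrow> ('k \<Rightarrow> 'a \<Rightarrow> 'a)
    \<Rightarrow> ('m \<Rightarrow> 'a) \<Rightarrow> bool"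
  where "linear_on K M A sM sA f \<longleftrightarrow>
    (\<forall>u\<in>M. f u \<in> A) \<and>
    (\<forall>u\<in>M. \<forall>v\<in>M. f (u + v) = f u + f v) \<and>
    (\<forall>c\<in>K. \<forall>u\<in>M. f (sM c u) = sA c (f u))"

definition gen_rota_baxter_system ::
  "'k set \<Rightarrow> 'm::plus set \<Rightarrow> 'a::plus set \<Rightarrow> ('k \<Rightarrow> 'm \<Rightarrow> 'm) \<Rightarrow> ('k \<Rightarrow> 'a \<Rightarrow> 'a)
    \<Rightarrow> ('a \<Rightarrow> 'a \<Rightarrow> 'a) \<Rightarrow> ('a \<Rightarrow> 'm \<Rightarrow> 'm) \<Rightarrow> ('m \<Rightarrow> 'a \<Rightarrow> 'm)
    \<Rightarrow> ('m \<Rightarrow> 'a) \<Rightarrow> ('m \<Rightarrow> 'a) \<Rightarrow> bool"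
  where "gen_rota_baxter_system K M A sM sA mul lact ract R S \<longleftrightarrow>
    linear_on K M A sM sA R \<and> linear_on K M A sM sA S \<and>
    (\<forall>u\<in>M. \<forall>v\<in>M. mul (R u) (R v) = R (lact (R u) v + ract u (S v))) \<and>
    (\<forall>u\<in>M. \<forall>v\<in>M. mul (S u) (S v) = S (lact (R u) v + ract u (S v)))"

text \<open>
  \<open>V[[t]]/(t\<^sup>N\<^sup>+\<^sup>1)\<close> is modelled by the unique representatives of degree at most \<open>N\<close>; addition is
  that of \<open>V[[t]]\<close>, and \<open>trunc_ext N b\<close> is the \<open>K[[t]]/(t\<^sup>N\<^sup>+\<^sup>1)\<close>-bilinear extension of a
  bilinear map \<open>b\<close>.
\<close>

definition trunc :: "nat \<Rightarrow> 'v::zero fps set"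
  where "trunc N = {f. \<forall>n>N. fps_nth f n = 0}"

definition trunc_ext ::
  "nat \<Rightarrow> ('v \<Rightarrow> 'w \<Rightarrow> 'x::comm_monoid_add) \<Rightarrow> 'v fps \<Rightarrow> 'w fps \<Rightarrow> 'x fps"
  where "trunc_ext N b f g =
    Abs_fps (\<lambda>n. if n \<le> N then \<Sum>i\<le>n. b (fps_nth f i) (fps_nth g (n - i)) else 0)"

text \<open>
  Every associativity law of the truncated structures (for the scalars, the algebra and the
  actions) is an instance of the following.
\<close>

lemma trunc_ext_assoc:
  assumes add1: "\<And>x x' z. b1 (x + x') z = b1 x z + b1 x' z"
    and add3: "\<And>x y y'. b3 x (y + y') = b3 x y + b3 x y'"
    and zero1: "\<And>z. b1 0 z = 0" and zero3: "\<And>x. b3 x 0 = 0"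
    and assoc: "\<And>x y z. b1 (b2 x y) z = b3 x (b4 y z)"
  shows "trunc_ext N b1 (trunc_ext N b2 f g) h = trunc_ext N b3 f (trunc_ext N b4 g h)"
proof (rule fps_ext)
  fix n
  have s1: "b1 (sum p I) z = (\<Sum>i\<in>I. b1 (p i) z)" for p and I :: "nat set" and z
    by (induction I rule: infinite_finite_induct) (simp_all add: add1 zero1)
  have s3: "b3 x (sum p I) = (\<Sum>i\<in>I. b3 x (p i))" for p and I :: "nat set" and x
    by (induction I rule: infinite_finite_induct) (simp_all add: add3 zero3)
  let ?f = "fps_nth f" and ?g = "fps_nth g" and ?h = "fps_nth h"
  show "fps_nth (trunc_ext N b1 (trunc_ext N b2 f g) h) n
      = fps_nth (trunc_ext N b3 f (trunc_ext N b4 g h)) n"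
  proof (cases "n \<le> N")
    case True
    have "(\<Sum>j\<le>n. \<Sum>i\<le>j. b3 (?f i) (b4 (?g (j - i)) (?h (n - j))))
        = (\<Sum>i\<le>n. \<Sum>j\<le>n - i. b3 (?f i) (b4 (?g j) (?h (n - i - j))))"
      using fps_mult_assoc_lemma[where k = n and f = "\<lambda>i j k. b3 (?f i) (b4 (?g j) (?h k))"]
      by (simp add: atMost_atLeast0)
    moreover have "n - i \<le> N" for i using True by simp
    ultimately show ?thesis
      using True by (simp add: trunc_ext_def s1 s3 assoc)
  qed (simp add: trunc_ext_def)
qed

text \<open>
  \<open>\<Sum>i\<le>N. t\<^sup>i R\<^sub>i\<close>, extended to \<open>M[[t]]/(t\<^sup>N\<^sup>+\<^sup>1)\<close>; only the values of \<open>R\<close> at indices up to \<open>N\<close> are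
  relevant.
\<close>

definition trunc_series_map ::
  "nat \<Rightarrow> (nat \<Rightarrow> 'm \<Rightarrow> 'a::comm_monoid_add) \<Rightarrow> 'm fps \<Rightarrow> 'a fps"
  where "trunc_series_map N R u =
    Abs_fps (\<lambda>n. if n \<le> N then \<Sum>i\<le>n. R i (fps_nth u (n - i)) else 0)"

definition deformation_of_order ::
  "('k::field_char_0 \<Rightarrow> 'a::ring \<Rightarrow> 'a) \<Rightarrow> ('k \<Rightarrow> 'm::ab_group_add \<Rightarrow> 'm)
    \<Rightarrow> ('a \<Rightarrow> 'm \<Rightarrow> 'm) \<Rightarrow> ('m \<Rightarrow> 'a \<Rightarrow> 'm) \<Rightarrow> ('m \<Rightarrow> 'a) \<Rightarrow> ('m \<Rightarrow> 'a)
    \<Rightarrow> nat \<Rightarrow> (nat \<Rightarrow> 'm \<Rightarrow> 'a) \<Rightarrow> (nat \<Rightarrow> 'm \<Rightarrow> 'a) \<Rightarrow> bool"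
  where "deformation_of_order scaleA scaleM lact ract R S N Rs Ss \<longleftrightarrow>
    (\<forall>i\<le>N. module_hom scaleM scaleA (Rs i) \<and> module_hom scaleM scaleA (Ss i)) \<and>
    Rs 0 = R \<and> Ss 0 = S \<and>
    gen_rota_baxter_system (trunc N) (trunc N) (trunc N)
      (trunc_ext N scaleM) (trunc_ext N scaleA)
      (trunc_ext N (*)) (trunc_ext N lact) (trunc_ext N ract)
      (trunc_series_map N Rs) (trunc_series_map N Ss)"

text \<open>
  An element of \<open>Hom(M\<^sup>\<otimes>\<^sup>n, A \<oplus> A)\<close> is given by a multilinear function on argument lists of
  length \<open>n\<close>; its values on lists of other lengths are irrelevant.
\<close>

definition cochain ::
  "('k::field_char_0 \<Rightarrow> 'a::ring \<Rightarrow> 'a) \<Rightarrow> ('k \<Rightarrow> 'm::ab_group_add \<Rightarrow> 'm)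
    \<Rightarrow> nat \<Rightarrow> ('m list \<Rightarrow> 'a \<times> 'a) \<Rightarrow> bool"
  where "cochain scaleA scaleM n F \<longleftrightarrow>
    (\<forall>us i. length us = n \<longrightarrow> i < n \<longrightarrow>
      module_hom scaleM (module_prod.scale scaleA scaleA) (\<lambda>x. F (us[i := x])))"

text \<open>
  The component of the bracket selected by \<open>pr\<close> (\<open>fst\<close> for the first, \<open>snd\<close> for the second).
  The argument \<open>u\<^sub>i\<close> is \<open>us ! (i - 1)\<close>, and \<open>take n (drop (i - 1) us)\<close> is the list
  \<open>u\<^sub>i, \<dots>, u\<^sub>i\<^sub>+\<^sub>n\<^sub>-\<^sub>1\<close>. Signs are scalars because the algebra need not have a unit.
\<close>

definition bracket_comp ::
  "('k::field_char_0 \<Rightarrow> 'a::ring \<Rightarrow> 'a) \<Rightarrow> ('a \<Rightarrow> 'm \<Rightarrow> 'm) \<Rightarrow> ('m \<Rightarrow> 'a \<Rightarrow> 'm)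
    \<Rightarrow> ('a \<times> 'a \<Rightarrow> 'a) \<Rightarrow> nat \<Rightarrow> ('m list \<Rightarrow> 'a \<times> 'a) \<Rightarrow> nat \<Rightarrow> ('m list \<Rightarrow> 'a \<times> 'a)
    \<Rightarrow> 'm list \<Rightarrow> 'a"
  where "bracket_comp scaleA lact ract pr m F n G us =
    (\<Sum>i=1..m. scaleA ((-1) ^ ((i - 1) * n))
        (pr (F (take (i - 1) us
                @ [lact (fst (G (take n (drop (i - 1) us)))) (us ! (i + n - 1))]
                @ drop (i + n) us))))
    - (\<Sum>i=1..m. scaleA ((-1) ^ (i * n))
        (pr (F (take (i - 1) us
                @ [ract (us ! (i - 1)) (snd (G (take n (drop i us))))]
                @ drop (i + n) us))))
    - scaleA ((-1) ^ (m * n))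
       ((\<Sum>i=1..n. scaleA ((-1) ^ ((i - 1) * m))
          (pr (G (take (i - 1) us
                  @ [lact (fst (F (take m (drop (i - 1) us)))) (us ! (i + m - 1))]
                  @ drop (i + m) us))))
        - (\<Sum>i=1..n. scaleA ((-1) ^ (i * m))
          (pr (G (take (i - 1) us
                  @ [ract (us ! (i - 1)) (snd (F (take m (drop i us))))]
                  @ drop (i + m) us)))))
    + scaleA ((-1) ^ (m * n))
       (pr (F (take m us)) * pr (G (drop m us))
        - scaleA ((-1) ^ (m * n)) (pr (G (take n us)) * pr (F (drop n us))))"

definition bracket ::
  "('k::field_char_0 \<Rightarrow> 'a::ring \<Rightarrow> 'a) \<Rightarrow> ('a \<Rightarrow> 'm \<Rightarrow> 'm) \<Rightarrow> ('m \<Rightarrow> 'a \<Rightarrow> 'm)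
    \<Rightarrow> nat \<Rightarrow> ('m list \<Rightarrow> 'a \<times> 'a) \<Rightarrow> nat \<Rightarrow> ('m list \<Rightarrow> 'a \<times> 'a) \<Rightarrow> 'm list \<Rightarrow> 'a \<times> 'a"
  where "bracket scaleA lact ract m F n G us =
    (bracket_comp scaleA lact ract fst m F n G us,
     bracket_comp scaleA lact ract snd m F n G us)"

definition pair_cochain :: "('m \<Rightarrow> 'a) \<Rightarrow> ('m \<Rightarrow> 'a) \<Rightarrow> 'm list \<Rightarrow> 'a \<times> 'a"
  where "pair_cochain R S us = (R (us ! 0), S (us ! 0))"

definition rb_differential ::
  "('k::field_char_0 \<Rightarrow> 'a::ring \<Rightarrow> 'a) \<Rightarrow> ('a \<Rightarrow> 'm \<Rightarrow> 'm) \<Rightarrow> ('m \<Rightarrow> 'a \<Rightarrow> 'm)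
    \<Rightarrow> ('m \<Rightarrow> 'a) \<Rightarrow> ('m \<Rightarrow> 'a) \<Rightarrow> nat \<Rightarrow> ('m list \<Rightarrow> 'a \<times> 'a) \<Rightarrow> 'm list \<Rightarrow> 'a \<times> 'a"
  where "rb_differential scaleA lact ract R S n F =
    bracket scaleA lact ract 1 (pair_cochain R S) n F"

definition rb_cocycle ::
  "('k::field_char_0 \<Rightarrow> 'a::ring \<Rightarrow> 'a) \<Rightarrow> ('k \<Rightarrow> 'm::ab_group_add \<Rightarrow> 'm)
    \<Rightarrow> ('a \<Rightarrow> 'm \<Rightarrow> 'm) \<Rightarrow> ('m \<Rightarrow> 'a \<Rightarrow> 'm) \<Rightarrow> ('m \<Rightarrow> 'a) \<Rightarrow> ('m \<Rightarrow> 'a)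
    \<Rightarrow> nat \<Rightarrow> ('m list \<Rightarrow> 'a \<times> 'a) \<Rightarrow> bool"
  where "rb_cocycle scaleA scaleM lact ract R S n F \<longleftrightarrow>
    cochain scaleA scaleM n F \<and>
    (\<forall>us. length us = n + 1 \<longrightarrow> rb_differential scaleA lact ract R S n F us = 0)"

definition obstruction ::
  "('k::field_char_0 \<Rightarrow> 'a::ring \<Rightarrow> 'a) \<Rightarrow> ('a \<Rightarrow> 'm \<Rightarrow> 'm) \<Rightarrow> ('m \<Rightarrow> 'a \<Rightarrow> 'm)
    \<Rightarrow> nat \<Rightarrow> (nat \<Rightarrow> 'm \<Rightarrow> 'a) \<Rightarrow> (nat \<Rightarrow> 'm \<Rightarrow> 'a) \<Rightarrow> 'm list \<Rightarrow> 'a \<times> 'a"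
  where "obstruction scaleA lact ract N Rs Ss us =
    module_prod.scale scaleA scaleA (- (1 / 2))
      (\<Sum>(i, j) \<in> {(i, j). i + j = N + 1 \<and> 1 \<le> i \<and> 1 \<le> j}.
        bracket scaleA lact ract
          1 (pair_cochain (Rs i) (Ss i)) 1 (pair_cochain (Rs j) (Ss j)) us)"

end

(*
  Bianchi identity: for arbitrary linear families R_t, S_t and T = R or S, the curvature
  P_T(u, v) = T_t u * T_t v - T_t (u o v), with u o v = R_t u . v + u . S_t v, satisfies
    T_t (P_R(u, v) . w) - T_t (u . P_S(v, w)) - P_T(u o v, w) + P_T(u, v o w)
      + T_t u * P_T(v, w) - P_T(u, v) * T_t w = 0.
  For a deformation of order N the curvature starts in degree N + 1, where its coefficient is the
  obstruction, so the coefficient of t^(N+1) in the identity is the cocycle equation.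
*)

theory Submission
  imports Defs
begin

section \<open>Permuting the indices in sums over triples with i + j + k = n\<close>

lemma sum_triples_swap12:
  fixes f :: "nat \<Rightarrow> nat \<Rightarrow> nat \<Rightarrow> 'b::comm_monoid_add"
  shows "(\<Sum>i\<le>n. \<Sum>j\<le>n - i. f j i (n - i - j)) = (\<Sum>i\<le>n. \<Sum>j\<le>n - i. f i j (n - i - j))"
  unfolding sum.Sigma[OF finite_atMost ballI[OF finite_atMost]]
  by (rule sum.reindex_bij_witness[where i = "\<lambda>(i, j). (j, i)" and j = "\<lambda>(i, j). (j, i)"])
    (auto simp: algebra_simps)

lemma sum_triples_swap23:
  fixes f :: "nat \<Rightarrow> nat \<Rightarrow> nat \<Rightarrow> 'b::comm_monoid_add"
  shows "(\<Sum>i\<le>n. \<Sum>j\<le>n - i. f i (n - i - j) j) = (\<Sum>i\<le>n. \<Sum>j\<le>n - i. f i j (n - i - j))"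
proof (rule sum.cong[OF refl])
  fix i
  show "(\<Sum>j\<le>n - i. f i (n - i - j) j) = (\<Sum>j\<le>n - i. f i j (n - i - j))"
    using fps_mult_commute_lemma[of "f i" "n - i"] by (simp add: atMost_atLeast0)
qed

lemma sum_triples_rotate:
  fixes f :: "nat \<Rightarrow> nat \<Rightarrow> nat \<Rightarrow> 'b::comm_monoid_add"
  shows "(\<Sum>i\<le>n. \<Sum>j\<le>n - i. f j (n - i - j) i) = (\<Sum>i\<le>n. \<Sum>j\<le>n - i. f i j (n - i - j))"
  using sum_triples_swap12[where f = "\<lambda>i j k. f i k j"] sum_triples_swap23[where f = f]
  by simp

text \<open>For a generalized Rota-Baxter system this is the induced associative product on the
  bimodule; for arbitrary linear maps the curvature controls its associator.\<close>

definition circ_product ::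
  "('a \<Rightarrow> 'm \<Rightarrow> 'm) \<Rightarrow> ('m \<Rightarrow> 'a \<Rightarrow> 'm) \<Rightarrow> ('m \<Rightarrow> 'a) \<Rightarrow> ('m \<Rightarrow> 'a) \<Rightarrow> 'm \<Rightarrow> 'm \<Rightarrow> 'm::plus"
  where "circ_product lact ract r s u v = lact (r u) v + ract u (s v)"

text \<open>
  The coefficient of \<open>t\<^sup>n\<close> in \<open>T\<^sub>t u * T\<^sub>t v - T\<^sub>t (R\<^sub>t u \<cdot> v + u \<cdot> S\<^sub>t v)\<close>, for \<open>T\<close> either of \<open>R\<close>, \<open>S\<close>.
\<close>

definition curvature ::
  "('a::ring \<Rightarrow> 'm \<Rightarrow> 'm) \<Rightarrow> ('m \<Rightarrow> 'a \<Rightarrow> 'm) \<Rightarrow> (nat \<Rightarrow> 'm \<Rightarrow> 'a) \<Rightarrow> (nat \<Rightarrow> 'm \<Rightarrow> 'a)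
    \<Rightarrow> (nat \<Rightarrow> 'm \<Rightarrow> 'a) \<Rightarrow> nat \<Rightarrow> 'm \<Rightarrow> 'm::ab_group_add \<Rightarrow> 'a"
  where "curvature lact ract R S T n u v =
    (\<Sum>i\<le>n. T i u * T (n - i) v - T i (circ_product lact ract (R (n - i)) (S (n - i)) u v))"

section \<open>The Bianchi identity and its lowest-degree coefficient\<close>

context algebra_bimodule
begin

abbreviation "circ \<equiv> circ_product lact ract"
abbreviation "curv \<equiv> curvature lact ract"

lemmas lact_hom_simps =
  module_hom.add[OF lact_linear_left] module_hom.add[OF lact_linear_right]
  module_hom.diff[OF lact_linear_left] module_hom.diff[OF lact_linear_right]
  module_hom.sum[OF lact_linear_left] module_hom.sum[OF lact_linear_right]

lemmas ract_hom_simps =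
  module_hom.add[OF ract_linear_left] module_hom.add[OF ract_linear_right]
  module_hom.diff[OF ract_linear_left] module_hom.diff[OF ract_linear_right]
  module_hom.sum[OF ract_linear_left] module_hom.sum[OF ract_linear_right]

text \<open>Each of the six sums expands into sums over triples i + j + k = n. The cubic products
  cancel between \<open>?E5\<close> and \<open>?E6\<close>, the products with one circle product
  inside cancel between \<open>?E4\<close> and \<open>?E5\<close> and between \<open>?E3\<close> and
  \<open>?E6\<close>. All remaining terms lie under \<open>T i\<close> and cancel for each triple
  separately.\<close>

lemma curvature_bianchi:
  assumes R: "\<And>i. module_hom scaleM scaleA (R i)"
    and S: "\<And>i. module_hom scaleM scaleA (S i)"
    and T: "\<And>i. module_hom scaleM scaleA (T i)"
  shows "(\<Sum>i\<le>n. T i (lact (curv R S R (n - i) u v) w))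
    - (\<Sum>i\<le>n. T i (ract u (curv R S S (n - i) v w)))
    - (\<Sum>i\<le>n. curv R S T (n - i) (circ (R i) (S i) u v) w)
    + (\<Sum>i\<le>n. curv R S T (n - i) u (circ (R i) (S i) v w))
    + (\<Sum>i\<le>n. T i u * curv R S T (n - i) v w) - (\<Sum>i\<le>n. curv R S T (n - i) u v * T i w) = 0"
    (is "?E1 - ?E2 - ?E3 + ?E4 + ?E5 - ?E6 = 0")
proof -
  define tri :: "(nat \<Rightarrow> nat \<Rightarrow> nat \<Rightarrow> 'a) \<Rightarrow> 'a"
    where "tri f = (\<Sum>i\<le>n. \<Sum>j\<le>n - i. f i j (n - i - j))" for f
  note hom = module_hom.add[OF T] module_hom.diff[OF T] module_hom.sum[OF T]
    lact_hom_simps ract_hom_simps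
  let ?c = "\<lambda>i. circ (R i) (S i)"
  have swap12: "tri (\<lambda>i j k. f j i k) = tri f" and swap23: "tri (\<lambda>i j k. f i k j) = tri f"
    and rotate: "tri (\<lambda>i j k. f j k i) = tri f" for f
    unfolding tri_def by (rule sum_triples_swap12 sum_triples_swap23 sum_triples_rotate)+
  have tri_add: "tri f + tri g = tri (\<lambda>i j k. f i j k + g i j k)"
    and tri_diff: "tri f - tri g = tri (\<lambda>i j k. f i j k - g i j k)" for f g
    by (simp_all add: tri_def sum.distrib sum_subtractf)
  \<comment> \<open>In all six expansions the indices are arranged so that u o v carries j and v o w
    carries k; the cancelling sums then agree literally.\<close>
  have E1: "?E1 = tri (\<lambda>i j k. T i (lact (R j u * R k v) w))
      - tri (\<lambda>i j k. T i (lact (R k (?c j u v)) w))"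
    using swap23[of "\<lambda>i j k. T i (lact (R k (?c j u v)) w)"]
    by (simp add: curvature_def tri_def hom sum_subtractf)
  have E2: "?E2 = tri (\<lambda>i j k. T i (ract u (S j v * S k w)))
      - tri (\<lambda>i j k. T i (ract u (S j (?c k v w))))"
    by (simp add: curvature_def tri_def hom sum_subtractf)
  have E3: "?E3 = tri (\<lambda>i j k. T i (?c j u v) * T k w) - tri (\<lambda>i j k. T i (?c k (?c j u v) w))"
    using swap12[of "\<lambda>i j k. T i (?c j u v) * T k w"]
      swap12[of "\<lambda>i j k. T i (?c k (?c j u v) w)"]
    by (simp add: curvature_def tri_def sum_subtractf)
  have E4: "?E4 = tri (\<lambda>i j k. T i u * T j (?c k v w)) - tri (\<lambda>i j k. T i (?c j u (?c k v w)))"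
    using rotate[of "\<lambda>i j k. T i u * T j (?c k v w)"]
      rotate[of "\<lambda>i j k. T i (?c j u (?c k v w))"]
    by (simp add: curvature_def tri_def sum_subtractf)
  have E5: "?E5 = tri (\<lambda>i j k. T i u * T j v * T k w) - tri (\<lambda>i j k. T i u * T j (?c k v w))"
    by (simp add: curvature_def tri_def sum_distrib_left sum_subtractf algebra_simps)
  have E6: "?E6 = tri (\<lambda>i j k. T i u * T j v * T k w) - tri (\<lambda>i j k. T i (?c j u v) * T k w)"
    using rotate[of "\<lambda>i j k. T i u * T j v * T k w"]
      rotate[of "\<lambda>i j k. T i (?c j u v) * T k w"]
    by (simp add: curvature_def tri_def sum_distrib_right sum_subtractf left_diff_distrib)
  \<comment> \<open>Under \<open>T i\<close>, this computes the associator (u o v) o w - u o (v o w)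
    for circle products with indices j and k from the bimodule axioms.\<close>
  have assoc: "T i (lact (R j u * R k v) w) - T i (lact (R k (?c j u v)) w)
      - (T i (ract u (S j v * S k w)) - T i (ract u (S j (?c k v w))))
      + T i (?c k (?c j u v) w) - T i (?c j u (?c k v w)) = 0" for i j k
    by (simp add: circ_product_def hom lact_mult ract_mult lact_ract module_hom.add[OF R]
        module_hom.add[OF S])
  have "?E1 - ?E2 - ?E3 + ?E4 + ?E5 - ?E6 = tri (\<lambda>i j k. T i (lact (R j u * R k v) w))
      - tri (\<lambda>i j k. T i (lact (R k (?c j u v)) w))
      - (tri (\<lambda>i j k. T i (ract u (S j v * S k w)))
      - tri (\<lambda>i j k. T i (ract u (S j (?c k v w)))))
      + tri (\<lambda>i j k. T i (?c k (?c j u v) w)) - tri (\<lambda>i j k. T i (?c j u (?c k v w)))"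
    unfolding E1 E2 E3 E4 E5 E6 by simp
  also have "\<dots> = 0"
    unfolding tri_add tri_diff assoc by (simp add: tri_def)
  finally show ?thesis .
qed

text \<open>Every sum in the Bianchi identity is a convolution with the curvature; when the
  curvature vanishes below degree \<open>n\<close>, only the summand i = 0 survives.\<close>

lemma curvature_bianchi_leading:
  assumes "\<And>i. module_hom scaleM scaleA (R i)" "\<And>i. module_hom scaleM scaleA (S i)"
    and T: "\<And>i. module_hom scaleM scaleA (T i)"
    and R0: "\<forall>m<n. \<forall>u v. curv R S R m u v = 0"
    and S0: "\<forall>m<n. \<forall>u v. curv R S S m u v = 0"
    and T0: "\<forall>m<n. \<forall>u v. curv R S T m u v = 0"
  shows "T 0 (lact (curv R S R n u v) w) - T 0 (ract u (curv R S S n v w))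
    - curv R S T n (circ (R 0) (S 0) u v) w + curv R S T n u (circ (R 0) (S 0) v w)
    + T 0 u * curv R S T n v w - curv R S T n u v * T 0 w = 0"
proof -
  have leading: "(\<Sum>i\<le>n. f i) = f 0" if "\<And>i. 0 < i \<Longrightarrow> i \<le> n \<Longrightarrow> f i = 0" for f :: "nat \<Rightarrow> 'a"
    using sum.mono_neutral_right[of "{..n}" "{0}" f] that by auto
  have zero: "T i (lact 0 w) = 0" "T i (ract u 0) = 0" for i
    by (simp_all add: module_hom.zero[OF T] module_hom.zero[OF lact_linear_left]
        module_hom.zero[OF ract_linear_right])
  show ?thesis
    using curvature_bianchi[of R S T n u v w, OF assms(1-3)]
    by (simp add: leading R0 S0 T0 zero)
qed

section \<open>Linearity of the curvature and its vanishing in low degrees\<close>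

lemma module_hom_mult_left: "module_hom scaleM scaleA f \<Longrightarrow> module_hom scaleM scaleA (\<lambda>x. a * f x)"
  and module_hom_mult_right: "module_hom scaleM scaleA f \<Longrightarrow> module_hom scaleM scaleA (\<lambda>x. f x * a)"
  by (simp_all add: module_hom_iff distrib_left distrib_right scaleA_mult_left scaleA_mult_right)

lemma module_hom_circ:
  assumes "module_hom scaleM scaleA r" "module_hom scaleM scaleA s"
  shows "module_hom scaleM scaleM (\<lambda>x. circ r s x v)"
    and "module_hom scaleM scaleM (\<lambda>x. circ r s u x)"
  using assms lact_linear_left lact_linear_right ract_linear_left ract_linear_right
  by (simp_all add: circ_product_def module_hom_iff M.scale_right_distrib)

text \<open>This makes the obstruction a cochain, and it splits the curvature at a circle product
  into the two terms that occur in the differential.\<close>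

lemma module_hom_curvature:
  assumes R: "\<And>i. module_hom scaleM scaleA (R i)"
    and S: "\<And>i. module_hom scaleM scaleA (S i)"
    and T: "\<And>i. module_hom scaleM scaleA (T i)"
  shows "module_hom scaleM scaleA (\<lambda>x. curv R S T n x v)"
    and "module_hom scaleM scaleA (\<lambda>x. curv R S T n u x)"
proof -
  interpret module_pair scaleM scaleA ..
  note comp = module_hom_compose[OF _ T, unfolded comp_def]
  show "module_hom scaleM scaleA (\<lambda>x. curv R S T n x v)"
    unfolding curvature_def
    by (intro module_hom_sum module_hom_sub module_hom_mult_right comp module_hom_circ R S T)
      (simp add: M.module_axioms A.module_axioms)
  show "module_hom scaleM scaleA (\<lambda>x. curv R S T n u x)"
    unfolding curvature_def
    by (intro module_hom_sum module_hom_sub module_hom_mult_left comp module_hom_circ R S T)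
      (simp add: M.module_axioms A.module_axioms)
qed

text \<open>Evaluate the truncated Rota-Baxter identities on the constant series u and v and compare
  the coefficients of t^n, which truncation leaves intact for \<open>n \<le> N\<close>.\<close>

lemma curvature_deformation_eq_0:
  assumes def: "deformation_of_order scaleA scaleM lact ract R S N Rs Ss"
    and n: "n \<le> N"
  shows "curv Rs Ss Rs n u v = 0" and "curv Rs Ss Ss n u v = 0"
proof -
  let ?u = "fps_const u" and ?v = "fps_const v"
  let ?R = "trunc_series_map N Rs" and ?S = "trunc_series_map N Ss"
  let ?w = "trunc_ext N lact (?R ?u) ?v + trunc_ext N ract ?u (?S ?v)"
  have hom: "module_hom scaleM scaleA (Rs i)" "module_hom scaleM scaleA (Ss i)" if "i \<le> N" for i
    using def that by (auto simp: deformation_of_order_def)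
  have mem: "fps_const x \<in> trunc N" for x :: 'm
    by (simp add: trunc_def)
  \<comment> \<open>A constant series has its only nonzero coefficient at index 0, so j = i alone
    contributes.\<close>
  have R: "fps_nth (?R (fps_const x)) i = Rs i x"
    and S: "fps_nth (?S (fps_const x)) i = Ss i x" if "i \<le> N" for x i
  proof -
    have "(\<Sum>j\<le>i. T j (if i - j = 0 then x else 0)) = T i x"
      if "\<And>j. j \<le> N \<Longrightarrow> module_hom scaleM scaleA (T j)" for T :: "nat \<Rightarrow> 'm \<Rightarrow> 'a"
    proof -
      have "(\<Sum>j\<le>i. T j (if i - j = 0 then x else 0)) = (\<Sum>j\<in>{i}. T j (if i - j = 0 then x else 0))"
        using \<open>i \<le> N\<close> by (intro sum.mono_neutral_right) (auto simp: module_hom.zero[OF that])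
      then show ?thesis by simp
    qed
    then show "fps_nth (?R (fps_const x)) i = Rs i x" "fps_nth (?S (fps_const x)) i = Ss i x"
      using hom \<open>i \<le> N\<close> by (simp_all add: trunc_series_map_def)
  qed
  \<comment> \<open>The constant v leaves only j = i in the left action, the constant u only j = 0
    in the right action.\<close>
  have w: "fps_nth ?w i = circ (Rs i) (Ss i) u v" if "i \<le> N" for i
  proof -
    have "(\<Sum>j\<le>i. lact (fps_nth (?R ?u) j) (fps_nth ?v (i - j)))
        = (\<Sum>j\<in>{i}. lact (fps_nth (?R ?u) j) (fps_nth ?v (i - j)))"
      by (intro sum.mono_neutral_right) (auto simp: module_hom.zero[OF lact_linear_right])
    moreover have "(\<Sum>j\<le>i. ract (fps_nth ?u j) (fps_nth (?S ?v) (i - j)))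
        = (\<Sum>j\<in>{0}. ract (fps_nth ?u j) (fps_nth (?S ?v) (i - j)))"
      by (intro sum.mono_neutral_right) (auto simp: module_hom.zero[OF ract_linear_left])
    ultimately show ?thesis
      using that by (simp add: trunc_ext_def circ_product_def R S)
  qed
  have "trunc_ext N (*) (?R ?u) (?R ?v) = ?R ?w" "trunc_ext N (*) (?S ?u) (?S ?v) = ?S ?w"
    using def mem by (auto simp: deformation_of_order_def gen_rota_baxter_system_def)
  then have "fps_nth (trunc_ext N (*) (?R ?u) (?R ?v)) n = fps_nth (?R ?w) n"
    "fps_nth (trunc_ext N (*) (?S ?u) (?S ?v)) n = fps_nth (?S ?w) n"
    by simp_all
  moreover have "fps_nth (?R ?w) n = (\<Sum>i\<le>n. Rs i (circ (Rs (n - i)) (Ss (n - i)) u v))"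
    "fps_nth (?S ?w) n = (\<Sum>i\<le>n. Ss i (circ (Rs (n - i)) (Ss (n - i)) u v))"
    using n w by (simp_all add: trunc_series_map_def del: fps_add_nth)
  moreover have "fps_nth (trunc_ext N (*) (?R ?u) (?R ?v)) n = (\<Sum>i\<le>n. Rs i u * Rs (n - i) v)"
    "fps_nth (trunc_ext N (*) (?S ?u) (?S ?v)) n = (\<Sum>i\<le>n. Ss i u * Ss (n - i) v)"
    using n R S by (simp_all add: trunc_ext_def)
  ultimately show "curv Rs Ss Rs n u v = 0" "curv Rs Ss Ss n u v = 0"
    by (simp_all add: curvature_def sum_subtractf)
qed

section \<open>The bracket and the differential in low degree, and the obstruction as
  curvature\<close>

lemma bracket_pair_cochain:
  "bracket scaleA lact ract 1 (pair_cochain R S) 1 (pair_cochain R' S') [u, v] =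
    (R (circ R' S' u v) + R' (circ R S u v) - (R u * R' v + R' u * R v),
     S (circ R' S' u v) + S' (circ R S u v) - (S u * S' v + S' u * S v))"
  if "module_hom scaleM scaleA R" "module_hom scaleM scaleA S"
    "module_hom scaleM scaleA R'" "module_hom scaleM scaleA S'"
  using that
  by (simp add: bracket_def bracket_comp_def pair_cochain_def circ_product_def module_hom.add)

text \<open>Since \<open>F\<close> is arbitrary, its values on the two summands of a circle product
  stay separate. Once these are merged, each component is the lowest-degree Bianchi expression with
  \<open>F\<close> in place of the curvature.\<close>

lemma rb_differential_2:
  "rb_differential scaleA lact ract R S 2 F [u, v, w] =
    (R (lact (fst (F [u, v])) w) - R (ract u (snd (F [v, w])))
      - (fst (F [lact (R u) v, w]) + fst (F [ract u (S v), w]))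
      + (fst (F [u, lact (R v) w]) + fst (F [u, ract v (S w)]))
      + R u * fst (F [v, w]) - fst (F [u, v]) * R w,
     S (lact (fst (F [u, v])) w) - S (ract u (snd (F [v, w])))
      - (snd (F [lact (R u) v, w]) + snd (F [ract u (S v), w]))
      + (snd (F [u, lact (R v) w]) + snd (F [u, ract v (S w)]))
      + S u * snd (F [v, w]) - snd (F [u, v]) * S w)"
  by (simp add: rb_differential_def bracket_def bracket_comp_def pair_cochain_def numeral_2_eq_2)

text \<open>
  Dropping all terms beyond degree \<open>N\<close> makes the degree \<open>N + 1\<close> curvature equal to the obstruction:
  the contributions of the pairs \<open>(0, N + 1)\<close> and \<open>(N + 1, 0)\<close> vanish.
\<close>

definition cut :: "nat \<Rightarrow> (nat \<Rightarrow> 'm \<Rightarrow> 'a) \<Rightarrow> nat \<Rightarrow> 'm \<Rightarrow> 'a"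
  where "cut N T i = (if i \<le> N then T i else (\<lambda>_. 0))"

lemma module_hom_cut:
  assumes "\<And>i. i \<le> N \<Longrightarrow> module_hom scaleM scaleA (T i)"
  shows "module_hom scaleM scaleA (cut N T i)"
proof -
  interpret module_pair scaleM scaleA ..
  show ?thesis using assms by (simp add: cut_def module_hom_zero)
qed

lemma curvature_cut_Suc:
  assumes T: "\<And>i. i \<le> N \<Longrightarrow> module_hom scaleM scaleA (T i)"
  shows "curv (cut N R) (cut N S) (cut N T) (N + 1) u v
    = (\<Sum>i=1..N. T i u * T (N + 1 - i) v - T i (circ (R (N + 1 - i)) (S (N + 1 - i)) u v))"
proof -
  have "curv (cut N R) (cut N S) (cut N T) (N + 1) u v
    = (\<Sum>i=1..N. cut N T i u * cut N T (N + 1 - i) v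
        - cut N T i (circ (cut N R (N + 1 - i)) (cut N S (N + 1 - i)) u v))"
    unfolding curvature_def
  proof (rule sum.mono_neutral_right)
    show "\<forall>i\<in>{..N + 1} - {1..N}. cut N T i u * cut N T (N + 1 - i) v
        - cut N T i (circ (cut N R (N + 1 - i)) (cut N S (N + 1 - i)) u v) = 0"
    proof
      fix i assume "i \<in> {..N + 1} - {1..N}"
      \<comment> \<open>For i = 0 the circle product has the cut-off index N + 1, so
        \<open>T 0\<close> is applied to 0; for i = N + 1 the outer map itself is 0.\<close>
      then have "i = 0 \<or> i = N + 1" by auto
      then show "cut N T i u * cut N T (N + 1 - i) v
        - cut N T i (circ (cut N R (N + 1 - i)) (cut N S (N + 1 - i)) u v) = 0"
        using module_hom.zero[OF T[of 0]]
        by (auto simp: cut_def circ_product_def module_hom.zero[OF lact_linear_left]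
            module_hom.zero[OF ract_linear_right])
    qed
  qed auto
  also have "\<dots> = (\<Sum>i=1..N. T i u * T (N + 1 - i) v
      - T i (circ (R (N + 1 - i)) (S (N + 1 - i)) u v))"
    by (rule sum.cong) (auto simp: cut_def)
  finally show ?thesis .
qed

text \<open>The bracket of the pairs with indices i and N + 1 - i is minus the sum of the curvature
  terms at these two indices. Reversing the summation shows that both halves agree, so the total is
  -2 times the curvature, and the factor -1/2 restores it.\<close>

lemma obstruction_eq_curvature:
  assumes R: "\<And>i. i \<le> N \<Longrightarrow> module_hom scaleM scaleA (Rs i)"
    and S: "\<And>i. i \<le> N \<Longrightarrow> module_hom scaleM scaleA (Ss i)"
  shows "obstruction scaleA lact ract N Rs Ss [u, v] =
    (curv (cut N Rs) (cut N Ss) (cut N Rs) (N + 1) u v,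
     curv (cut N Rs) (cut N Ss) (cut N Ss) (N + 1) u v)"
proof -
  let ?n = "N + 1"
  let ?P = "{(i, j). i + j = ?n \<and> 1 \<le> i \<and> 1 \<le> j}"
  let ?B = "\<lambda>T i. T i (circ (Rs (?n - i)) (Ss (?n - i)) u v) + T (?n - i) (circ (Rs i) (Ss i) u v)
    - (T i u * T (?n - i) v + T (?n - i) u * T i v)"
  have pairs: "?P = (\<lambda>i. (i, ?n - i)) ` {1..N}"
    by (auto simp: image_iff)
  have inj: "inj_on (\<lambda>i. (i, ?n - i)) {1..N}"
    by (rule inj_onI) simp
  have "(\<Sum>(i, j)\<in>?P. bracket scaleA lact ract
        1 (pair_cochain (Rs i) (Ss i)) 1 (pair_cochain (Rs j) (Ss j)) [u, v])
      = (\<Sum>i=1..N. bracket scaleA lact ract 1 (pair_cochain (Rs i) (Ss i))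
          1 (pair_cochain (Rs (?n - i)) (Ss (?n - i))) [u, v])"
    unfolding pairs sum.reindex[OF inj] by simp
  also have "\<dots> = (\<Sum>i=1..N. (?B Rs i, ?B Ss i))"
    by (rule sum.cong[OF refl], rule bracket_pair_cochain) (auto intro: R S)
  also have "\<dots> = (\<Sum>i=1..N. ?B Rs i, \<Sum>i=1..N. ?B Ss i)"
    by (simp add: prod_eq_iff fst_sum snd_sum)
  finally have sum: "(\<Sum>(i, j)\<in>?P. bracket scaleA lact ract
        1 (pair_cochain (Rs i) (Ss i)) 1 (pair_cochain (Rs j) (Ss j)) [u, v])
      = (\<Sum>i=1..N. ?B Rs i, \<Sum>i=1..N. ?B Ss i)" .
  have half_double: "scaleA (- (1 / 2)) (- (d + d)) = d" for d
  proof -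
    have "scaleA (- (1 / 2)) (- (d + d)) = scaleA (1 / 2 + 1 / 2) d"
      by (simp only: A.scale_left_distrib A.scale_right_distrib A.scale_minus_left
          A.scale_minus_right minus_add_distrib minus_minus)
    then show ?thesis by simp
  qed
  have half: "scaleA (- (1 / 2)) (\<Sum>i=1..N. ?B T i)
      = (\<Sum>i=1..N. T i u * T (?n - i) v - T i (circ (Rs (?n - i)) (Ss (?n - i)) u v))"
      (is "_ = sum ?D _") for T
  proof -
    have rev: "(\<Sum>i=1..N. ?D (?n - i)) = (\<Sum>i=1..N. ?D i)"
      by (rule sum.atLeastAtMost_rev[of ?D 1 N, symmetric])
    have "(\<Sum>i=1..N. ?B T i) = (\<Sum>i=1..N. - (?D i + ?D (?n - i)))"
      by (rule sum.cong) (auto simp: algebra_simps)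
    also have "\<dots> = - ((\<Sum>i=1..N. ?D i) + (\<Sum>i=1..N. ?D (?n - i)))"
      by (simp only: sum_negf sum.distrib)
    also have "\<dots> = - ((\<Sum>i=1..N. ?D i) + (\<Sum>i=1..N. ?D i))"
      by (simp only: rev)
    finally have B: "(\<Sum>i=1..N. ?B T i) = - ((\<Sum>i=1..N. ?D i) + (\<Sum>i=1..N. ?D i))" .
    show ?thesis
      unfolding B by (rule half_double)
  qed
  have curvR: "curv (cut N Rs) (cut N Ss) (cut N Rs) ?n u v
      = scaleA (- (1 / 2)) (\<Sum>i=1..N. ?B Rs i)"
    unfolding half[of Rs] by (rule curvature_cut_Suc) (rule R)
  have curvS: "curv (cut N Rs) (cut N Ss) (cut N Ss) ?n u v
      = scaleA (- (1 / 2)) (\<Sum>i=1..N. ?B Ss i)"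
    unfolding half[of Ss] by (rule curvature_cut_Suc) (rule S)
  interpret P: module_prod scaleA scaleA ..
  show ?thesis
    unfolding obstruction_def sum P.scale_prod curvR curvS ..
qed

end

section \<open>Multilinearity of the obstruction and its cocycle equation\<close>

theorem proposition4p7:
  fixes scaleA :: "'k::field_char_0 \<Rightarrow> 'a::ring \<Rightarrow> 'a"
    and scaleM :: "'k \<Rightarrow> 'm::ab_group_add \<Rightarrow> 'm"
    and lact :: "'a \<Rightarrow> 'm \<Rightarrow> 'm"
    and ract :: "'m \<Rightarrow> 'a \<Rightarrow> 'm"
    and R S :: "'m \<Rightarrow> 'a"
    and N :: nat
    and Rs Ss :: "nat \<Rightarrow> 'm \<Rightarrow> 'a"
  assumes "algebra_bimodule scaleA scaleM lact ract"
    and "gen_rota_baxter_system UNIV UNIV UNIV scaleM scaleA (*) lact ract R S"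
    and "deformation_of_order scaleA scaleM lact ract R S N Rs Ss"
  shows "rb_cocycle scaleA scaleM lact ract R S 2 (obstruction scaleA lact ract N Rs Ss)"
proof -
  interpret algebra_bimodule scaleA scaleM lact ract by fact
  interpret P: vector_space_prod scaleA scaleA ..
  note def = assms(3)
  let ?Ob = "obstruction scaleA lact ract N Rs Ss"
  let ?R = "cut N Rs" and ?S = "cut N Ss"
  have hom: "module_hom scaleM scaleA (Rs i)" "module_hom scaleM scaleA (Ss i)" if "i \<le> N" for i
    using def that by (auto simp: deformation_of_order_def)
  \<comment> \<open>The deformation gives linearity only up to degree N; the cut families are linear
    in every degree, as the Bianchi identity demands.\<close>
  have R: "module_hom scaleM scaleA (?R i)" and S: "module_hom scaleM scaleA (?S i)" for i
    using hom by (auto intro: module_hom_cut)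
  have zero: "?R 0 = R" "?S 0 = S"
    using def by (simp_all add: cut_def deformation_of_order_def)
  \<comment> \<open>In degree at most N the curvature involves only indices up to N, where cutting
    changes nothing.\<close>
  have curv_cut: "curv ?R ?S (cut N T) m u v = curv Rs Ss T m u v" if "m < N + 1" for T m u v
    unfolding curvature_def using that by (intro sum.cong) (auto simp: cut_def)
  have low: "\<forall>m<N + 1. \<forall>u v. curv ?R ?S ?R m u v = 0"
    "\<forall>m<N + 1. \<forall>u v. curv ?R ?S ?S m u v = 0"
    by (simp_all add: curv_cut curvature_deformation_eq_0[OF def])
  let ?cR = "curv ?R ?S ?R (N + 1)" and ?cS = "curv ?R ?S ?S (N + 1)"
  have Ob: "?Ob [u, v] = (?cR u v, ?cS u v)" for u v
    using hom by (rule obstruction_eq_curvature)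
  note curv_hom = module_hom_curvature[OF R S R] module_hom_curvature[OF R S S]
  have "cochain scaleA scaleM 2 ?Ob"
    unfolding cochain_def
  proof (intro allI impI)
    fix us :: "'m list" and i :: nat
    assume "length us = 2" "i < 2"
    then obtain u v where us: "us = [u, v]"
      by (auto simp: length_Suc_conv numeral_2_eq_2)
    have Pair: "module_hom scaleM P.scale (\<lambda>x. (f x, g x))"
      if "module_hom scaleM scaleA f" "module_hom scaleM scaleA g" for f g
      using that by (simp add: module_hom_iff P.scale_prod P.p.module_axioms)
    consider "i = 0" | "i = 1"
      using \<open>i < 2\<close> by linarith
    then show "module_hom scaleM P.scale (\<lambda>x. ?Ob (us[i := x]))"
    proof cases
      case 1
      then have "(\<lambda>x. ?Ob (us[i := x])) = (\<lambda>x. (?cR x v, ?cS x v))"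
        by (simp only: us list_update_code Ob)
      then show ?thesis
        by (simp only: Pair curv_hom)
    next
      case 2
      then have "(\<lambda>x. ?Ob (us[i := x])) = (\<lambda>x. (?cR u x, ?cS u x))"
        by (simp only: us list_update_code Ob One_nat_def)
      then show ?thesis
        by (simp only: Pair curv_hom)
    qed
  qed
  moreover have "rb_differential scaleA lact ract R S 2 ?Ob us = 0"
    if len: "length us = 2 + 1" for us
  proof -
    obtain u v w where us: "us = [u, v, w]"
      using len by (auto simp: length_Suc_conv numeral_3_eq_3)
    \<comment> \<open>T = R gives the first component of the cocycle equation, T = S the
      second.\<close>
    note bianchi = curvature_bianchi_leading[OF R S R low low(1), of u v w]
      curvature_bianchi_leading[OF R S S low low(2), of u v w]
    show ?thesis
      \<comment> \<open>Index 0 of the cut families is the original system, and additivity of the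
        curvature splits its values at circle products to match the differential.\<close>
      using bianchi[unfolded zero circ_product_def curv_hom[THEN module_hom.add]]
      by (simp only: us rb_differential_2 Ob fst_conv snd_conv zero_prod_def)
  qed
  ultimately show ?thesis
    unfolding rb_cocycle_def by blast
qed

end
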